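(* Let $I$ be an arbitrary (possibly infinite) index set and let $R_i$ for $i\in I$ be nonzero commutative $D$-rings such that the multiplicative monoids $(R_i,\cdot)$ are pairwise nonisomorphic. Then $$\mathrm{Aut}\left(\prod_{i\in I}(R_i,\cdot)\right)\cong\prod_{i\in I}\mathrm{Aut}(R_i,\cdot)$$ as groups.
   Context: Rings are unital. A commutative ring $R$ is a $D$-ring if every zero divisor of $R$ is nilpotent. $(R,\cdot)$ denotes the multiplicative monoid of $R$, and $\mathrm{Aut}$ denotes the group of monoid automorphisms (not assumed to preserve addition). *)

theory Defs
  imports "HOL-Algebra.Ring" "HOL-Algebra.Bij" "HOL-Algebra.Product_Groups"
begin

abbreviation mult_monoid :: "('a, 'm) ring_scheme \<Rightarrow> 'a monoid"
  where "mult_monoid R \<equiv> \<lparr>carrier = carrier R, monoid.mult = monoid.mult R, one = one R\<rparr>"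

(* Zero itself counts as a zero divisor in a nonzero ring; as it is nilpotent, the
   notion of D-ring does not depend on this convention. *)
definition zero_divisor :: "('a, 'm) ring_scheme \<Rightarrow> 'a \<Rightarrow> bool"
  where "zero_divisor R a \<longleftrightarrow>
    a \<in> carrier R \<and> (\<exists>b\<in>carrier R. b \<noteq> \<zero>\<^bsub>R\<^esub> \<and> a \<otimes>\<^bsub>R\<^esub> b = \<zero>\<^bsub>R\<^esub>)"

definition nilpotent :: "('a, 'm) ring_scheme \<Rightarrow> 'a \<Rightarrow> bool"
  where "nilpotent R a \<longleftrightarrow> a \<in> carrier R \<and> (\<exists>n::nat. a [^]\<^bsub>R\<^esub> n = \<zero>\<^bsub>R\<^esub>)"

definition D_ring :: "('a, 'm) ring_scheme \<Rightarrow> bool"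
  where "D_ring R \<longleftrightarrow> cring R \<and> (\<forall>a. zero_divisor R a \<longrightarrow> nilpotent R a)"

(* The library's iso and auto only ask for bijectivity and compatibility with
   multiplication. The next lemma shows that this is the usual notion for monoids: the
   unit is preserved automatically. The library proves that AutoGroup G is a group only
   when G is a group; below this is shown for every monoid. *)

lemma iso_monoid_one:
  assumes "monoid G" "monoid H" "h \<in> iso G H"
  shows "h \<one>\<^bsub>G\<^esub> = \<one>\<^bsub>H\<^esub>"
proof -
  interpret G: monoid G by fact
  interpret H: monoid H by fact
  have h: "h \<in> hom G H" "h ` carrier G = carrier H"
    using assms(3) by (auto simp: iso_iff)
  obtain x where x: "x \<in> carrier G" "h x = \<one>\<^bsub>H\<^esub>"
    using h(2) H.one_closed by (metis imageE)
  have "h \<one>\<^bsub>G\<^esub> = h \<one>\<^bsub>G\<^esub> \<otimes>\<^bsub>H\<^esub> h x"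
    using x(2) h(2) H.r_one G.one_closed by (metis imageI)
  also have "\<dots> = h (\<one>\<^bsub>G\<^esub> \<otimes>\<^bsub>G\<^esub> x)"
    using hom_mult[OF h(1) G.one_closed x(1)] by simp
  finally show ?thesis
    using x by simp
qed

lemma group_AutoGroup_monoid:
  assumes "monoid G"
  shows "group (AutoGroup G)"
proof -
  interpret monoid G by fact
  have "subgroup (auto G) (BijGroup (carrier G))"
  proof (rule subgroup.intro)
    show "auto G \<subseteq> carrier (BijGroup (carrier G))"
      by (auto simp: auto_def BijGroup_def)
  next
    fix x y assume "x \<in> auto G" "y \<in> auto G"
    then show "x \<otimes>\<^bsub>BijGroup (carrier G)\<^esub> y \<in> auto G"
      by (auto simp: BijGroup_def auto_def hom_def Pi_iff compose_eq
          intro: compose_Bij)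
  next
    show "\<one>\<^bsub>BijGroup (carrier G)\<^esub> \<in> auto G"
      by (auto simp: BijGroup_def auto_def hom_def id_Bij)
  next
    fix x assume "x \<in> auto G"
    then have x: "x \<in> hom G G" "x \<in> Bij (carrier G)"
      by (auto simp: auto_def)
    have "restrict (inv_into (carrier G) x) (carrier G) \<in> hom G G"
      using x Bij_inv_into_lemma[of "carrier G" x "monoid.mult G"]
      by (auto simp: hom_def Bij_inv_into_mem)
    then show "inv\<^bsub>BijGroup (carrier G)\<^esub> x \<in> auto G"
      using x by (simp add: inv_BijGroup auto_def restrict_inv_into_Bij)
  qed
  then show ?thesis
    by (simp add: AutoGroup_def subgroup.subgroup_is_group group_BijGroup)
qed

end

theory Submission
  imports Defs
begin

text \<open>The idempotents of a nontrivial D-ring are 0 and 1, so the idempotents of the product are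
  the indicators of subsets of I, and every automorphism permutes the indicators of
  singletons. An automorphism that maps the indicator of i to that of j restricts to an
  isomorphism from the i-th onto the j-th factor, hence i = j; so each factor is
  preserved and the automorphism acts componentwise.\<close>

text \<open>The argument for the product is purely multiplicative: addition and the D-ring condition
  serve only to exclude idempotents other than 0 and 1. It is therefore set among monoids with an
  absorbing element \<open>z i\<close>.\<close>

locale connected_monoid_family =
  fixes I :: "'i set" and M :: "'i \<Rightarrow> ('a, 'm) monoid_scheme" and z :: "'i \<Rightarrow> 'a"
  assumes monoid: "i \<in> I \<Longrightarrow> monoid (M i)"
    and z_closed [simp]: "i \<in> I \<Longrightarrow> z i \<in> carrier (M i)"
    and z_left [simp]: "\<lbrakk>i \<in> I; x \<in> carrier (M i)\<rbrakk> \<Longrightarrow> z i \<otimes>\<^bsub>M i\<^esub> x = z i"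
    and z_right [simp]: "\<lbrakk>i \<in> I; x \<in> carrier (M i)\<rbrakk> \<Longrightarrow> x \<otimes>\<^bsub>M i\<^esub> z i = z i"
    and one_neq_z: "i \<in> I \<Longrightarrow> \<one>\<^bsub>M i\<^esub> \<noteq> z i"
    and idem: "\<lbrakk>i \<in> I; x \<in> carrier (M i); x \<otimes>\<^bsub>M i\<^esub> x = x\<rbrakk> \<Longrightarrow> x = z i \<or> x = \<one>\<^bsub>M i\<^esub>"
begin

section \<open>Elements of the product supported at one index, and their images under
  automorphisms\<close>

definition P where "P = product_group I M"

text \<open>Padding with absorbing elements embeds \<open>M i\<close> multiplicatively as an axis of
  the product, on which \<open>ind i\<close> acts as the identity.\<close>

definition single :: "'i \<Rightarrow> 'a \<Rightarrow> 'i \<Rightarrow> 'a"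
  where "single i x = (\<lambda>k\<in>I. if k = i then x else z k)"

abbreviation ind :: "'i \<Rightarrow> 'i \<Rightarrow> 'a"
  where "ind i \<equiv> single i \<one>\<^bsub>M i\<^esub>"

lemma factor_simps [simp]:
  assumes "i \<in> I"
  shows "\<one>\<^bsub>M i\<^esub> \<in> carrier (M i)"
    and "\<lbrakk>x \<in> carrier (M i); y \<in> carrier (M i)\<rbrakk> \<Longrightarrow> x \<otimes>\<^bsub>M i\<^esub> y \<in> carrier (M i)"
    and "x \<in> carrier (M i) \<Longrightarrow> x \<otimes>\<^bsub>M i\<^esub> \<one>\<^bsub>M i\<^esub> = x"
    and "x \<in> carrier (M i) \<Longrightarrow> \<one>\<^bsub>M i\<^esub> \<otimes>\<^bsub>M i\<^esub> x = x"
  using monoid[OF assms]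
  by (auto simp: monoid.one_closed monoid.m_closed monoid.r_one monoid.l_one)

lemma carrier_P: "carrier P = (\<Pi>\<^sub>E i\<in>I. carrier (M i))"
  by (simp add: P_def)

lemma mult_P [simp]: "i \<in> I \<Longrightarrow> (x \<otimes>\<^bsub>P\<^esub> y) i = x i \<otimes>\<^bsub>M i\<^esub> y i"
  by (simp add: P_def)

lemma P_component [simp]: "\<lbrakk>x \<in> carrier P; i \<in> I\<rbrakk> \<Longrightarrow> x i \<in> carrier (M i)"
  by (auto simp: carrier_P)

lemma P_eqI:
  assumes "x \<in> carrier P" "y \<in> carrier P" "\<And>i. i \<in> I \<Longrightarrow> x i = y i"
  shows "x = y"
  using assms by (auto simp: carrier_P intro: PiE_ext)

lemma mult_P_closed [simp]: "\<lbrakk>x \<in> carrier P; y \<in> carrier P\<rbrakk> \<Longrightarrow> x \<otimes>\<^bsub>P\<^esub> y \<in> carrier P"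
  by (auto simp: P_def PiE_mem)

lemma single_closed [simp]: "x \<in> carrier (M i) \<Longrightarrow> single i x \<in> carrier P"
  by (auto simp: single_def carrier_P)

lemma single_apply [simp]: "k \<in> I \<Longrightarrow> single i x k = (if k = i then x else z k)"
  by (simp add: single_def)

lemma single_self: "i \<in> I \<Longrightarrow> single i x i = x"
  by simp

text \<open>Projection to an axis is expressed by multiplication alone, so an automorphism that maps
  \<open>ind i\<close> to \<open>ind j\<close> carries one projection to the other.\<close>

lemma mult_ind:
  assumes "x \<in> carrier P" "i \<in> I"
  shows "x \<otimes>\<^bsub>P\<^esub> ind i = single i (x i)"
  using assms by (intro P_eqI) auto

lemma single_mult:
  assumes "i \<in> I" "x \<in> carrier (M i)" "y \<in> carrier (M i)"
  shows "single i x \<otimes>\<^bsub>P\<^esub> single i y = single i (x \<otimes>\<^bsub>M i\<^esub> y)"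
  using assms by (intro P_eqI) auto

text \<open>Among the idempotents, \<open>ind i\<close> is minimal nonzero. Its image is a nonzero
  idempotent, hence lies above some \<open>ind j\<close>; the preimage of \<open>ind j\<close> is
  then a nonzero idempotent below \<open>ind i\<close>, so it equals \<open>ind i\<close>.\<close>

lemma aut_ind:
  assumes f: "f \<in> auto P" and i: "i \<in> I"
  obtains j where "j \<in> I" "f (ind i) = ind j"
proof -
  have hom: "f (x \<otimes>\<^bsub>P\<^esub> y) = f x \<otimes>\<^bsub>P\<^esub> f y" if "x \<in> carrier P" "y \<in> carrier P" for x y
    using f that by (auto simp: auto_def hom_def)
  have bij: "bij_betw f (carrier P) (carrier P)"
    using f by (auto simp: auto_def Bij_def)
  then have closed: "f x \<in> carrier P" if "x \<in> carrier P" for x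
    using that by (rule bij_betw_apply)
  have inj: "x = y" if "x \<in> carrier P" "y \<in> carrier P" "f x = f y" for x y
    using bij that by (auto simp: bij_betw_def dest: inj_onD)
  have surj: "\<exists>x\<in>carrier P. f x = y" if "y \<in> carrier P" for y
    using bij that by (simp add: bij_betw_def) (metis imageE)
  have idem_P: "x k = z k \<or> x k = \<one>\<^bsub>M k\<^esub>"
    if "x \<in> carrier P" "x \<otimes>\<^bsub>P\<^esub> x = x" "k \<in> I" for x k
    using that idem[of k "x k"] by (auto dest: fun_cong[of _ _ k])
  define zero where "zero = (\<lambda>k\<in>I. z k)"
  have zero: "zero \<in> carrier P"
    by (auto simp: zero_def carrier_P)
  have zero_left: "zero \<otimes>\<^bsub>P\<^esub> x = zero" and zero_right: "x \<otimes>\<^bsub>P\<^esub> zero = zero"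
    if "x \<in> carrier P" for x
    using that zero by (auto intro!: P_eqI simp: zero_def)
  have ind_neq_zero: "ind k \<noteq> zero" if "k \<in> I" for k
    using that one_neq_z by (auto simp: zero_def dest!: fun_cong[of _ _ k])
  \<comment> \<open>Members of \<open>auto P\<close> are only known to be multiplicative bijections.
    Surjectivity gives preservation of the absorbing element: \<open>f zero\<close> =
    \<open>f zero\<close> times \<open>f u\<close> = \<open>zero\<close>.\<close>
  obtain u where u: "u \<in> carrier P" "f u = zero"
    using surj[OF zero] by blast
  have f_zero: "f zero = zero"
    using hom[OF zero u(1)] u closed[OF zero] zero_left zero_right by simp
  define a where "a = f (ind i)"
  have a: "a \<in> carrier P" "a \<otimes>\<^bsub>P\<^esub> a = a"
    using i closed hom[of "ind i" "ind i"] by (auto simp: a_def single_mult)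
  have "a \<noteq> zero"
  proof
    assume "a = zero"
    then have "ind i = zero"
      using inj[of "ind i" zero] i zero f_zero by (simp add: a_def)
    then show False
      using ind_neq_zero i by simp
  qed
  then obtain j where j: "j \<in> I" "a j \<noteq> z j"
    using P_eqI[OF a(1) zero] by (auto simp: zero_def)
  then have aj: "a j = \<one>\<^bsub>M j\<^esub>"
    using idem_P a by blast
  obtain b where b: "b \<in> carrier P" "f b = ind j"
    using surj[of "ind j"] j by auto
  have bb: "b \<otimes>\<^bsub>P\<^esub> b = b"
    by (rule inj) (use b j hom in \<open>auto simp: single_mult\<close>)
  \<comment> \<open>Since \<open>a j\<close> is one, \<open>ind j\<close> lies below
    \<open>a\<close>; injectivity of \<open>f\<close> transfers this to \<open>b\<close> lying below
    \<open>ind i\<close>, that is, on the axis of \<open>i\<close>.\<close>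
  have "f (b \<otimes>\<^bsub>P\<^esub> ind i) = ind j \<otimes>\<^bsub>P\<^esub> a"
    using b i hom by (simp add: a_def)
  also have "\<dots> = ind j"
    using a j aj by (intro P_eqI) auto
  finally have "b \<otimes>\<^bsub>P\<^esub> ind i = b"
    using inj b i by simp
  then have bi: "b = single i (b i)"
    using mult_ind b i by simp
  have "b i \<noteq> z i"
  proof
    assume "b i = z i"
    then have "b = zero"
      by (subst bi) (auto simp: single_def zero_def)
    then have "ind j = zero"
      using b f_zero by simp
    then show False
      using ind_neq_zero j by simp
  qed
  then have "b = ind i"
    using idem_P[OF b(1) bb i] bi by simp
  then show ?thesis
    using that j b by blast
qed

text \<open>The axis of \<open>i\<close> consists of the multiples of \<open>ind i\<close>, so
  \<open>f\<close> takes it onto the axis of \<open>j\<close>. The map embeds into the first axis,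
  applies \<open>f\<close> and reads off the coordinate at \<open>j\<close>.\<close>

lemma aut_restrict_iso:
  assumes f: "f \<in> auto P" and i: "i \<in> I" and j: "j \<in> I" and fij: "f (ind i) = ind j"
  shows "(\<lambda>x. f (single i x) j) \<in> iso (M i) (M j)"
proof -
  have hom: "f (x \<otimes>\<^bsub>P\<^esub> y) = f x \<otimes>\<^bsub>P\<^esub> f y" if "x \<in> carrier P" "y \<in> carrier P" for x y
    using f that by (auto simp: auto_def hom_def)
  have bij: "bij_betw f (carrier P) (carrier P)"
    using f by (auto simp: auto_def Bij_def)
  then have closed: "f x \<in> carrier P" if "x \<in> carrier P" for x
    using that by (rule bij_betw_apply)
  have inj: "x = y" if "x \<in> carrier P" "y \<in> carrier P" "f x = f y" for x y
    using bij that by (auto simp: bij_betw_def dest: inj_onD)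
  \<comment> \<open>For \<open>x\<close> on the axis of \<open>i\<close> this says that
    \<open>f x\<close> is determined by its coordinate at \<open>j\<close>, which gives injectivity
    below; for general \<open>x\<close> it gives surjectivity.\<close>
  have f_single: "f (single i (x i)) = single j (f x j)" if "x \<in> carrier P" for x
    using hom[of x "ind i"] that i j fij mult_ind[of x i] mult_ind[of "f x" j] closed by simp
  show ?thesis
    unfolding iso_iff
  proof (intro conjI)
    show "(\<lambda>x. f (single i x) j) \<in> hom (M i) (M j)"
    proof (rule homI)
      fix x y assume xy: "x \<in> carrier (M i)" "y \<in> carrier (M i)"
      then show "f (single i (x \<otimes>\<^bsub>M i\<^esub> y)) j = f (single i x) j \<otimes>\<^bsub>M j\<^esub> f (single i y) j"
        using hom[of "single i x" "single i y"] i j by (simp flip: single_mult)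
    qed (use closed j in simp)
    show "inj_on (\<lambda>x. f (single i x) j) (carrier (M i))"
    proof (rule inj_onI)
      fix x y assume xy: "x \<in> carrier (M i)" "y \<in> carrier (M i)"
        and "f (single i x) j = f (single i y) j"
      then have "f (single i x) = f (single i y)"
        using f_single[of "single i x"] f_single[of "single i y"] i by simp
      then have "single i x = single i y"
        using inj xy by simp
      then show "x = y"
        using i single_self by metis
    qed
    show "(\<lambda>x. f (single i x) j) ` carrier (M i) = carrier (M j)"
    proof (intro equalityI subsetI)
      fix y assume y: "y \<in> carrier (M j)"
      \<comment> \<open>This preimage is not known to lie on the axis of \<open>i\<close>, but
        projecting it there does not change the coordinate of its image at \<open>j\<close>.\<close>
      then obtain x where x: "x \<in> carrier P" "f x = single j y"
        using bij single_closed[OF y] unfolding bij_betw_def by (metis imageE)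
      then have "f (single i (x i)) j = y"
        using f_single[of x] j by simp
      then show "y \<in> (\<lambda>x. f (single i x) j) ` carrier (M i)"
        using x i by force
    qed (use closed j in auto)
  qed
qed

section \<open>Componentwise automorphisms of the product\<close>

definition componentwise :: "('i \<Rightarrow> 'a \<Rightarrow> 'a) \<Rightarrow> ('i \<Rightarrow> 'a) \<Rightarrow> 'i \<Rightarrow> 'a"
  where "componentwise g = (\<lambda>x\<in>carrier P. \<lambda>i\<in>I. g i (x i))"

lemma componentwise_auto:
  assumes g: "\<And>i. i \<in> I \<Longrightarrow> g i \<in> auto (M i)"
  shows "componentwise g \<in> auto P"
proof -
  have bij: "bij_betw (g i) (carrier (M i)) (carrier (M i))" if "i \<in> I" for i
    using g[OF that] by (auto simp: auto_def Bij_def)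
  have hom: "g i (x \<otimes>\<^bsub>M i\<^esub> y) = g i x \<otimes>\<^bsub>M i\<^esub> g i y"
    if "i \<in> I" "x \<in> carrier (M i)" "y \<in> carrier (M i)" for i x y
    using g[OF that(1)] that by (auto simp: auto_def hom_def)
  have closed: "componentwise g x \<in> carrier P" if "x \<in> carrier P" for x
    using that bij_betw_apply[OF bij] by (auto simp: componentwise_def carrier_P PiE_mem)
  have "inj_on (componentwise g) (carrier P)"
  proof (rule inj_onI)
    fix x y assume xy: "x \<in> carrier P" "y \<in> carrier P" "componentwise g x = componentwise g y"
    show "x = y"
    proof (rule P_eqI[OF xy(1,2)])
      fix i assume i: "i \<in> I"
      have "g i (x i) = g i (y i)"
        using fun_cong[OF xy(3), of i] xy i by (simp add: componentwise_def)
      then show "x i = y i"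
        using bij[OF i] xy i by (auto simp: bij_betw_def dest: inj_onD)
    qed
  qed
  moreover have "y \<in> componentwise g ` carrier P" if y: "y \<in> carrier P" for y
  proof
    define x where "x = (\<lambda>i\<in>I. inv_into (carrier (M i)) (g i) (y i))"
    show x: "x \<in> carrier P"
      using y bij by (auto simp: x_def carrier_P bij_betw_def PiE_mem intro!: inv_into_into)
    show "y = componentwise g x"
      using y x closed bij
      by (intro P_eqI closed) (auto simp: componentwise_def x_def bij_betw_inv_into_right[OF bij])
  qed
  ultimately have "componentwise g \<in> Bij (carrier P)"
    using closed by (auto simp: Bij_def bij_betw_def componentwise_def)
  moreover have "componentwise g \<in> hom P P"
    by (intro homI P_eqI mult_P_closed closed) (auto simp: componentwise_def hom)
  ultimately show ?thesis
    by (simp add: auto_def)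
qed

text \<open>Each \<open>g i\<close> can be recovered: \<open>g i x\<close> is the coordinate at
  \<open>i\<close> of the image of \<open>single i x\<close>. Outside the carrier, members of
  \<open>auto (M i)\<close> agree by extensionality.\<close>

lemma componentwise_inj:
  "inj_on componentwise (\<Pi>\<^sub>E i\<in>I. auto (M i))"
proof (rule inj_onI)
  fix g h assume g: "g \<in> (\<Pi>\<^sub>E i\<in>I. auto (M i))" and h: "h \<in> (\<Pi>\<^sub>E i\<in>I. auto (M i))"
    and eq: "componentwise g = componentwise h"
  show "g = h"
  proof (rule PiE_ext[OF g h])
    fix i assume i: "i \<in> I"
    have "g i \<in> extensional (carrier (M i))" "h i \<in> extensional (carrier (M i))"
      using PiE_mem[OF g i] PiE_mem[OF h i] by (auto simp: auto_def Bij_def)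
    moreover have "g i x = h i x" if "x \<in> carrier (M i)" for x
      using fun_cong[OF fun_cong[OF eq, of "single i x"], of i] that i
      by (simp add: componentwise_def)
    ultimately show "g i = h i"
      by (rule extensionalityI)
  qed
qed

text \<open>Nonisomorphism forces \<open>j = i\<close> in \<open>aut_ind\<close>, so
  \<open>f\<close> fixes every \<open>ind i\<close> and commutes with every projection. Hence the
  coordinate of \<open>f x\<close> at \<open>i\<close> depends on \<open>x i\<close> alone.\<close>

lemma componentwise_surj:
  assumes f: "f \<in> auto P"
    and noniso: "\<And>i j. \<lbrakk>i \<in> I; j \<in> I; i \<noteq> j\<rbrakk> \<Longrightarrow> \<not> M i \<cong> M j"
  shows "f \<in> componentwise ` (\<Pi>\<^sub>E i\<in>I. auto (M i))"
proof
  \<comment> \<open>The candidate for \<open>g i\<close> is the action of \<open>f\<close> on the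
    axis of \<open>i\<close>, cut off outside the carrier because \<open>auto (M i)\<close> contains
    only extensional functions.\<close>
  define g where "g = (\<lambda>i\<in>I. \<lambda>x\<in>carrier (M i). f (single i x) i)"
  have hom: "f (x \<otimes>\<^bsub>P\<^esub> y) = f x \<otimes>\<^bsub>P\<^esub> f y" if "x \<in> carrier P" "y \<in> carrier P" for x y
    using f that by (auto simp: auto_def hom_def)
  have closed: "f x \<in> carrier P" if "x \<in> carrier P" for x
    using f that by (auto simp: auto_def hom_def)
  have fix_ind: "f (ind i) = ind i" if i: "i \<in> I" for i
  proof -
    obtain j where j: "j \<in> I" "f (ind i) = ind j"
      using aut_ind[OF f i] .
    then have "M i \<cong> M j"
      using aut_restrict_iso[OF f i] by (auto simp: is_iso_def)
    then show ?thesis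
      using noniso i j by metis
  qed
  have "g i \<in> auto (M i)" if i: "i \<in> I" for i
  proof -
    have *: "(\<lambda>x. f (single i x) i) \<in> iso (M i) (M i)"
      using aut_restrict_iso[OF f i i fix_ind[OF i]] .
    then have "g i \<in> hom (M i) (M i)"
      using i by (auto simp: g_def iso_def hom_def)
    moreover have "bij_betw (g i) (carrier (M i)) (carrier (M i))"
      using * i by (simp add: g_def iso_def cong: bij_betw_cong)
    ultimately show ?thesis
      using i by (simp add: auto_def Bij_def g_def)
  qed
  then show "g \<in> (\<Pi>\<^sub>E i\<in>I. auto (M i))"
    by (simp add: PiE_iff) (simp add: g_def)
  show "f = componentwise g"
  proof (rule extensionalityI)
    show "f \<in> extensional (carrier P)"
      using f by (auto simp: auto_def Bij_def)
    show "componentwise g \<in> extensional (carrier P)"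
      by (simp add: componentwise_def)
    fix x assume x: "x \<in> carrier P"
    have "f x i = f (single i (x i)) i" if i: "i \<in> I" for i
    proof -
      have "single i (f x i) = f (single i (x i))"
        using hom[OF x, of "ind i"] x i closed fix_ind mult_ind[of x i] mult_ind[of "f x" i]
        by simp
      then show ?thesis
        using i single_self by metis
    qed
    \<comment> \<open>At indices outside \<open>I\<close> both sides are
      \<open>undefined\<close>.\<close>
    then show "f x = componentwise g x"
      using x PiE_arb[of "f x" I "\<lambda>i. carrier (M i)"] closed[OF x]
      by (auto simp: componentwise_def g_def carrier_P fun_eq_iff PiE_mem)
  qed
qed

lemma componentwise_compose:
  assumes "\<And>i. i \<in> I \<Longrightarrow> g i \<in> auto (M i)" "\<And>i. i \<in> I \<Longrightarrow> h i \<in> auto (M i)"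
  shows "componentwise (\<lambda>i\<in>I. compose (carrier (M i)) (g i) (h i))
    = compose (carrier P) (componentwise g) (componentwise h)"
proof -
  \<comment> \<open>Both \<open>compose\<close> and \<open>componentwise\<close> are cut off outside
    the carrier; the inner value has to stay inside for the two sides to agree.\<close>
  have "componentwise h x \<in> carrier P" if "x \<in> carrier P" for x
    using componentwise_auto[of h] assms(2) that by (auto simp: auto_def hom_def)
  then show ?thesis
    by (auto simp: compose_def componentwise_def fun_eq_iff)
qed

lemma AutoGroup_product_iso:
  assumes noniso: "\<And>i j. \<lbrakk>i \<in> I; j \<in> I; i \<noteq> j\<rbrakk> \<Longrightarrow> \<not> M i \<cong> M j"
  shows "AutoGroup (product_group I M) \<cong> product_group I (\<lambda>i. AutoGroup (M i))"
proof -
  let ?A = "product_group I (\<lambda>i. AutoGroup (M i))"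
  have carrier_A: "carrier ?A = (\<Pi>\<^sub>E i\<in>I. auto (M i))"
    by (simp add: AutoGroup_def)
  have closed: "componentwise g \<in> auto P" if "g \<in> carrier ?A" for g
    using that unfolding carrier_A by (intro componentwise_auto) (rule PiE_mem)
  have "componentwise \<in> hom ?A (AutoGroup P)"
  proof (rule homI)
    fix g assume "g \<in> carrier ?A"
    then show "componentwise g \<in> carrier (AutoGroup P)"
      using closed by (simp add: AutoGroup_def)
  next
    fix g h assume gh: "g \<in> carrier ?A" "h \<in> carrier ?A"
    then have gh': "g i \<in> auto (M i)" "h i \<in> auto (M i)" if "i \<in> I" for i
      using PiE_mem[of _ I "\<lambda>i. auto (M i)"] that unfolding carrier_A by blast+
    have "g \<otimes>\<^bsub>?A\<^esub> h = (\<lambda>i\<in>I. compose (carrier (M i)) (g i) (h i))"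
      using gh' by (auto simp: AutoGroup_def BijGroup_def auto_def fun_eq_iff)
    moreover have "componentwise g \<otimes>\<^bsub>AutoGroup P\<^esub> componentwise h
        = compose (carrier P) (componentwise g) (componentwise h)"
      using closed[OF gh(1)] closed[OF gh(2)] by (simp add: AutoGroup_def BijGroup_def auto_def)
    ultimately show "componentwise (g \<otimes>\<^bsub>?A\<^esub> h)
        = componentwise g \<otimes>\<^bsub>AutoGroup P\<^esub> componentwise h"
      using componentwise_compose gh' by simp
  qed
  moreover have "componentwise ` carrier ?A = carrier (AutoGroup P)"
    using closed componentwise_surj[OF _ noniso]
    by (auto simp: AutoGroup_def)
  ultimately have "componentwise \<in> iso ?A (AutoGroup P)"
    using componentwise_inj by (simp add: iso_iff carrier_A del: carrier_product_group)
  \<comment> \<open>The isomorphism was built from the product of the automorphism groups; reversing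
    it by \<open>group.iso_sym\<close> requires its source to be a group.\<close>
  moreover have "group ?A"
    by (intro product_group group_AutoGroup_monoid monoid)
  ultimately show ?thesis
    unfolding P_def by (meson group.iso_sym is_isoI)
qed

end

section \<open>Idempotents of D-rings, and the application to rings\<close>

lemma D_ring_idempotent:
  assumes R: "D_ring R" and x: "x \<in> carrier R" "x \<otimes>\<^bsub>R\<^esub> x = x"
  shows "x = \<zero>\<^bsub>R\<^esub> \<or> x = \<one>\<^bsub>R\<^esub>"
proof (rule disjCI)
  interpret cring R
    using R by (simp add: D_ring_def)
  assume "x \<noteq> \<one>\<^bsub>R\<^esub>"
  \<comment> \<open>The complement 1 - x is the nonzero element that annihilates the idempotent x
    and makes it a zero divisor, hence nilpotent.\<close>
  then have "\<one>\<^bsub>R\<^esub> \<ominus>\<^bsub>R\<^esub> x \<noteq> \<zero>\<^bsub>R\<^esub>"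
    using x by (metis minus_eq minus_equality minus_minus a_inv_closed one_closed)
  moreover have "x \<otimes>\<^bsub>R\<^esub> (\<one>\<^bsub>R\<^esub> \<ominus>\<^bsub>R\<^esub> x) = \<zero>\<^bsub>R\<^esub>"
    using x by (simp add: minus_eq r_distr r_minus r_neg)
  ultimately have "zero_divisor R x"
    using x unfolding zero_divisor_def by blast
  then obtain n :: nat where n: "x [^]\<^bsub>R\<^esub> n = \<zero>\<^bsub>R\<^esub>"
    using R by (auto simp: D_ring_def nilpotent_def)
  \<comment> \<open>The extra factor x makes the identity hold for n = 0 as well; with the n-th
    power being zero it yields x = 0.\<close>
  have "x \<otimes>\<^bsub>R\<^esub> x [^]\<^bsub>R\<^esub> n = x"
    using x by (induction n) (simp_all add: m_assoc[symmetric])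
  then show "x = \<zero>\<^bsub>R\<^esub>"
    using n x by simp
qed

theorem corollary4p6:
  fixes I :: "'i set" and R :: "'i \<Rightarrow> ('a, 'm) ring_scheme"
  assumes "\<And>i. i \<in> I \<Longrightarrow> D_ring (R i)"
    and "\<And>i. i \<in> I \<Longrightarrow> \<one>\<^bsub>R i\<^esub> \<noteq> \<zero>\<^bsub>R i\<^esub>"
    and "\<And>i j. i \<in> I \<Longrightarrow> j \<in> I \<Longrightarrow> i \<noteq> j \<Longrightarrow> \<not> (mult_monoid (R i) \<cong> mult_monoid (R j))"
  shows "AutoGroup (product_group I (\<lambda>i. mult_monoid (R i)))
           \<cong> product_group I (\<lambda>i. AutoGroup (mult_monoid (R i)))"
proof -
  have cring: "cring (R i)" if "i \<in> I" for i
    using assms(1)[OF that] by (simp add: D_ring_def)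
  \<comment> \<open>The ring zeros are the absorbing elements; nontriviality gives
    \<open>one_neq_z\<close>, and the D-ring condition gives \<open>idem\<close>.\<close>
  interpret connected_monoid_family I "\<lambda>i. mult_monoid (R i)" "\<lambda>i. \<zero>\<^bsub>R i\<^esub>"
  proof (rule connected_monoid_family.intro)
    fix i assume i: "i \<in> I"
    interpret cring "R i"
      using cring[OF i] .
    show "monoid (mult_monoid (R i))"
      by (rule monoidI) (simp_all add: m_assoc)
    show "\<zero>\<^bsub>R i\<^esub> \<in> carrier (mult_monoid (R i))"
      by simp
    show "\<one>\<^bsub>mult_monoid (R i)\<^esub> \<noteq> \<zero>\<^bsub>R i\<^esub>"
      using assms(2)[OF i] by simp
    fix x assume "x \<in> carrier (mult_monoid (R i))"
    then have x: "x \<in> carrier (R i)"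
      by simp
    show "\<zero>\<^bsub>R i\<^esub> \<otimes>\<^bsub>mult_monoid (R i)\<^esub> x = \<zero>\<^bsub>R i\<^esub>"
      and "x \<otimes>\<^bsub>mult_monoid (R i)\<^esub> \<zero>\<^bsub>R i\<^esub> = \<zero>\<^bsub>R i\<^esub>"
      using x by simp_all
    assume "x \<otimes>\<^bsub>mult_monoid (R i)\<^esub> x = x"
    then show "x = \<zero>\<^bsub>R i\<^esub> \<or> x = \<one>\<^bsub>mult_monoid (R i)\<^esub>"
      using D_ring_idempotent[OF assms(1)[OF i] x] by simp
  qed
  show ?thesis
    using assms(3) by (rule AutoGroup_product_iso)
qed

end
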